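(* Let $k\ge1$ and $\ell$ be integers with $0\le\ell\le k$, and let $G=(V,E)$ be a $(k,\ell)$-tight hypergraph of dimension $s$ with $\ell\le sk-1$. Then the edge multiset $E$ can be partitioned into $E_1$ and $E_2$ such that $(V,E_1)$ is an $\ell$-arborescence and $(V,E_2)$ is a $(k-\ell)$-map.
   Context: A hypergraph $G=(V,E)$ consists of a finite vertex set $V$ and a finite multiset $E$ of nonempty subsets of $V$ (edges; parallel copies allowed, edges of size one are loops). The dimension of an edge $e$ is $|e|$; the dimension of $G$ is the minimum edge dimension. For $V'\subseteq V$, $E(V')$ is the multiset of edges contained in $V'$. $G$ is $(k,\ell)$-sparse if $|E(V')|\le k|V'|-\ell$ for every $V'\subseteq V$ with $E(V')$ nonempty, and $(k,\ell)$-tight if it is $(k,\ell)$-sparse and $|E|=k|V|-\ell$. A hypergraph $(V,T)$ is $1$-partition connected if for every partition of $V$ into $t$ nonempty parts at least $t-1$ edges of $T$ meet at least two parts; a tree is a hypergraph $(V,T)$ that is $1$-partition connected while no $(V,T\setminus\{f\})$, $f\in T$, is. A $j$-arborescence is a hypergraph $(V,E')$ whose edge multiset can be partitioned into $j$ sub-multisets each forming a tree on $V$ (for $j=0$, the edge multiset is empty). An orientation assigns to each edge one of its vertices (its tail). A map is a hypergraph $(V,M)$ admitting an orientation in which every vertex is the tail of exactly one edge; a $j$-map is a hypergraph $(V,E')$ whose edge multiset can be partitioned into $j$ sub-multisets each forming a map on $V$ (for $j=0$, empty). *)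

theory Defs
  imports Main "HOL-Library.Multiset" "HOL-Library.Disjoint_Sets"
begin

definition hypergraph :: "'a set \<Rightarrow> 'a set multiset \<Rightarrow> bool" where
  "hypergraph V E \<longleftrightarrow> finite V \<and> (\<forall>e\<in>#E. e \<noteq> {} \<and> e \<subseteq> V)"

(* Unspecified (Min of the empty set) for a hypergraph without edges. *)
definition hdimension :: "'a set multiset \<Rightarrow> nat" where
  "hdimension E = Min (card ` set_mset E)"

definition edges_in :: "'a set multiset \<Rightarrow> 'a set \<Rightarrow> 'a set multiset" where
  "edges_in E V' = {#e \<in># E. e \<subseteq> V'#}"

(* The bounds are integers: k|V'| - l must not be truncated at 0. *)
definition sparse :: "nat \<Rightarrow> nat \<Rightarrow> 'a set \<Rightarrow> 'a set multiset \<Rightarrow> bool" where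
  "sparse k l V E \<longleftrightarrow> hypergraph V E \<and>
     (\<forall>V'\<subseteq>V. edges_in E V' \<noteq> {#} \<longrightarrow>
        int (size (edges_in E V')) \<le> int k * int (card V') - int l)"

definition tight :: "nat \<Rightarrow> nat \<Rightarrow> 'a set \<Rightarrow> 'a set multiset \<Rightarrow> bool" where
  "tight k l V E \<longleftrightarrow> sparse k l V E \<and>
     int (size E) = int k * int (card V) - int l"

definition crossing :: "'a set set \<Rightarrow> 'a set \<Rightarrow> bool" where
  "crossing P e \<longleftrightarrow> (\<exists>X\<in>P. \<exists>Y\<in>P. X \<noteq> Y \<and> e \<inter> X \<noteq> {} \<and> e \<inter> Y \<noteq> {})"

definition one_partition_connected :: "'a set \<Rightarrow> 'a set multiset \<Rightarrow> bool" where
  "one_partition_connected V T \<longleftrightarrow> hypergraph V T \<and>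
     (\<forall>P. partition_on V P \<longrightarrow> int (card P) - 1 \<le> int (size {#e \<in># T. crossing P e#}))"

definition hypertree :: "'a set \<Rightarrow> 'a set multiset \<Rightarrow> bool" where
  "hypertree V T \<longleftrightarrow> one_partition_connected V T \<and>
     (\<forall>f\<in>#T. \<not> one_partition_connected V (T - {#f#}))"

definition arborescence :: "nat \<Rightarrow> 'a set \<Rightarrow> 'a set multiset \<Rightarrow> bool" where
  "arborescence j V E \<longleftrightarrow> hypergraph V E \<and>
     (\<exists>T. E = (\<Sum>i<j. T i) \<and> (\<forall>i<j. hypertree V (T i)))"

(* Parallel copies of an edge are indistinguishable in a multiset but may receive
   different tails, so an orientation is a multiset of (edge, tail) pairs, one for each
   copy of an edge. *)
definition orientation :: "'a set multiset \<Rightarrow> ('a set \<times> 'a) multiset \<Rightarrow> bool" where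
  "orientation M D \<longleftrightarrow> image_mset fst D = M \<and> (\<forall>(e, v)\<in>#D. v \<in> e)"

definition hypermap :: "'a set \<Rightarrow> 'a set multiset \<Rightarrow> bool" where
  "hypermap V M \<longleftrightarrow> hypergraph V M \<and>
     (\<exists>D. orientation M D \<and> (\<forall>v\<in>V. size {#p \<in># D. snd p = v#} = 1))"

definition multi_hypermap :: "nat \<Rightarrow> 'a set \<Rightarrow> 'a set multiset \<Rightarrow> bool" where
  "multi_hypermap j V E \<longleftrightarrow> hypergraph V E \<and>
     (\<exists>M. E = (\<Sum>i<j. M i) \<and> (\<forall>i<j. hypermap V (M i)))"

end

theory Submission
  imports Defs
begin

text \<open>
  Call a set \<open>J\<close> of edges \<open>c\<close>-independent if every nonempty vertex set \<open>X\<close> contains at most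
  \<open>card X - c\<close> edges of \<open>J\<close>. A 1-independent set with \<open>card V - 1\<close> edges is a tree, and by Hall's theorem
  a 0-independent set with \<open>card V\<close> edges is a map. By tightness it therefore suffices to cover \<open>E\<close> by \<open>l\<close>
  1-independent and \<open>k - l\<close> 0-independent classes. Take disjoint independent classes covering as
  many edges as possible. Matroid-partition exchanges starting from an uncovered edge \<open>e\<close> either enlarge
  the cover or yield an edge set \<open>S\<close> containing \<open>e\<close> such that every edge of \<open>S\<close> lies, for each class \<open>I\<close>,
  in a vertex set that is tight for \<open>I \<inter> S\<close>. Then one vertex set \<open>C\<close> containing \<open>e\<close> is tight
  for all classes simultaneously, so it contains \<open>k * card C - l\<close> covered edges besides \<open>e\<close>, contradicting
  sparsity.
\<close>

section \<open>Hall's marriage theorem\<close>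

text \<open>Induction on \<open>card I\<close>. If a nonempty proper subfamily \<open>J\<close> is
  critical, it is matched inside its union \<open>U\<close> and the rest outside \<open>U\<close>.
  Otherwise all such subfamilies have a surplus, and any \<open>x\<close> may take any
  \<open>v\<close> in \<open>B x\<close>.\<close>

lemma hall_marriage:
  fixes B :: "'i \<Rightarrow> 'a set"
  assumes "finite I" and "\<And>i. i \<in> I \<Longrightarrow> finite (B i)"
    and "\<And>J. J \<subseteq> I \<Longrightarrow> card J \<le> card (\<Union>(B ` J))"
  shows "\<exists>t. inj_on t I \<and> (\<forall>i\<in>I. t i \<in> B i)"
  using assms
proof (induction "card I" arbitrary: I B rule: less_induct)
  case less
  show ?case
  proof (cases "\<exists>J. J \<subset> I \<and> J \<noteq> {} \<and> card (\<Union>(B ` J)) \<le> card J")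
    case True
    then obtain J where J: "J \<subset> I" "J \<noteq> {}" "card (\<Union>(B ` J)) \<le> card J" by blast
    have fin: "finite J" "finite (I - J)" using J less.prems(1) by (auto intro: finite_subset)
    define U where "U = \<Union>(B ` J)"
    have finU: "finite U" using fin J less.prems(2) by (auto simp: U_def)
    have "\<exists>t. inj_on t J \<and> (\<forall>i\<in>J. t i \<in> B i)"
      using J less.prems by (intro less.hyps psubset_card_mono) (auto simp: fin)
    then obtain t1 where t1: "inj_on t1 J" "\<forall>i\<in>J. t1 i \<in> B i" by blast
    have "\<exists>t. inj_on t (I - J) \<and> (\<forall>i\<in>I - J. t i \<in> B i - U)"
    proof (intro less.hyps psubset_card_mono)
      fix K assume K: "K \<subseteq> I - J"
      then have finK: "finite K" using fin finite_subset by blast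
      have finBK: "finite (\<Union>i\<in>K. B i - U)" using finK K less.prems(2) by auto
      \<comment> \<open>Hall's condition for \<open>K\<close> outside \<open>U\<close> comes from
        the one for \<open>K \<union> J\<close>, since \<open>U\<close> has at most
        \<open>card J\<close> elements.\<close>
      have "card K + card J = card (K \<union> J)"
        using K by (intro card_Un_disjoint[symmetric] finK fin) auto
      also have "\<dots> \<le> card (\<Union>(B ` (K \<union> J)))"
        using K J by (intro less.prems(3)) auto
      also have "\<Union>(B ` (K \<union> J)) = (\<Union>i\<in>K. B i - U) \<union> U" by (auto simp: U_def)
      also have "card \<dots> \<le> card (\<Union>i\<in>K. B i - U) + card U" by (rule card_Un_le)
      finally show "card K \<le> card (\<Union>i\<in>K. B i - U)" using J(3) by (simp add: U_def)
    qed (use J less.prems fin in auto)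
    then obtain t2 where t2: "inj_on t2 (I - J)" "\<forall>i\<in>I - J. t2 i \<in> B i - U" by blast
    have t1U: "t1 i \<in> U" if "i \<in> J" for i using t1 that by (auto simp: U_def)
    define t where "t = (\<lambda>i. if i \<in> J then t1 i else t2 i)"
    have "inj_on t I"
    proof (rule inj_onI)
      fix x y assume xy: "x \<in> I" "y \<in> I" "t x = t y"
      have t2U: "t2 i \<notin> U" if "i \<in> I" "i \<notin> J" for i using t2 that by auto
      have same: "x \<in> J \<longleftrightarrow> y \<in> J"
        using xy t1U[of x] t1U[of y] t2U[of x] t2U[of y] by (simp add: t_def split: if_splits)
      show "x = y"
      proof (cases "x \<in> J")
        case True
        then show ?thesis using xy same by (simp add: t_def inj_on_eq_iff[OF t1(1)])
      next
        case False
        then show ?thesis using xy same by (simp add: t_def inj_on_eq_iff[OF t2(1)])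
      qed
    qed
    moreover have "\<forall>i\<in>I. t i \<in> B i" using t1 t2 by (auto simp: t_def)
    ultimately show ?thesis by blast
  next
    case False
    show ?thesis
    proof (cases "I = {}")
      case False
      then obtain x where x: "x \<in> I" by blast
      have "card {x} \<le> card (\<Union>(B ` {x}))" using x by (intro less.prems(3)) auto
      then obtain v where v: "v \<in> B x" by fastforce
      have "\<exists>t. inj_on t (I - {x}) \<and> (\<forall>i\<in>I - {x}. t i \<in> B i - {v})"
      proof (intro less.hyps psubset_card_mono)
        fix K assume K: "K \<subseteq> I - {x}"
        show "card K \<le> card (\<Union>i\<in>K. B i - {v})"
        proof (cases "K = {}")
          case False
          \<comment> \<open>The strict surplus of \<open>K\<close> makes up for the loss of
            \<open>v\<close>.\<close>
          then have "card K < card (\<Union>(B ` K))"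
            using K x \<open>\<not> (\<exists>J. J \<subset> I \<and> J \<noteq> {} \<and> card (\<Union>(B ` J)) \<le> card J)\<close>
            by (metis Diff_iff Diff_subset insertI1 linorder_not_less psubsetI subset_iff)
          moreover have "(\<Union>i\<in>K. B i - {v}) = \<Union>(B ` K) - {v}" by auto
          ultimately show ?thesis using diff_card_le_card_Diff[of "{v}" "\<Union>(B ` K)"] by simp
        qed simp
      qed (use x less.prems in auto)
      then obtain t where t: "inj_on t (I - {x})" "\<forall>i\<in>I - {x}. t i \<in> B i - {v}" by blast
      have "inj_on (t(x := v)) I" using t by (auto simp: inj_on_def)
      moreover have "\<forall>i\<in>I. (t(x := v)) i \<in> B i" using t v by auto
      ultimately show ?thesis by blast
    qed simp
  qed
qed

section \<open>Count matroids on an indexed edge set\<close>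

text \<open>Indices keep parallel edges apart, so that sub-multisets of edges become subsets of
  \<open>A\<close>.\<close>

locale indexed_hypergraph =
  fixes V :: "'a set" and A :: "'i set" and ed :: "'i \<Rightarrow> 'a set"
  assumes finV: "finite V" and finA: "finite A"
    and ed_V: "x \<in> A \<Longrightarrow> ed x \<subseteq> V" and ed_ne: "x \<in> A \<Longrightarrow> ed x \<noteq> {}"
begin

definition induced :: "'i set \<Rightarrow> 'a set \<Rightarrow> 'i set" where
  "induced J X = {x \<in> J. ed x \<subseteq> X}"

text \<open>The bound is imposed on every nonempty \<open>X\<close>, whether or not it contains an
  edge. Uncrossing thus needs only a common vertex. In return, singletons force
  \<open>c \<le> 1\<close> as soon as \<open>V\<close> is nonempty.\<close>

definition indep :: "nat \<Rightarrow> 'i set \<Rightarrow> bool" where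
  "indep c J \<longleftrightarrow> (\<forall>X\<subseteq>V. X \<noteq> {} \<longrightarrow> card (induced J X) + c \<le> card X)"

definition tight_on :: "nat \<Rightarrow> 'i set \<Rightarrow> 'a set \<Rightarrow> bool" where
  "tight_on c J X \<longleftrightarrow> X \<subseteq> V \<and> X \<noteq> {} \<and> card (induced J X) + c = card X"

text \<open>
  For independent \<open>J\<close> this is the matroid closure without the coloops of \<open>J\<close>: an edge of \<open>J\<close> itself
  has to lie in a tight set. Hence it is not extensive.
\<close>

definition span :: "nat \<Rightarrow> 'i set \<Rightarrow> 'i set" where
  "span c J = {x \<in> A. \<exists>X. tight_on c J X \<and> ed x \<subseteq> X}"

lemma finite_induced: "J \<subseteq> A \<Longrightarrow> finite (induced J X)"
  using finA by (auto simp: induced_def intro: finite_subset)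

lemma induced_mono: "J \<subseteq> K \<Longrightarrow> X \<subseteq> Y \<Longrightarrow> induced J X \<subseteq> induced K Y"
  by (auto simp: induced_def)

lemma card_induced_supermodular:
  assumes "J \<subseteq> A"
  shows "card (induced J X) + card (induced J Y) \<le> card (induced J (X \<union> Y)) + card (induced J (X \<inter> Y))"
proof -
  have "card (induced J X) + card (induced J Y)
      = card (induced J X \<union> induced J Y) + card (induced J X \<inter> induced J Y)"
    using assms by (intro card_Un_Int finite_induced)
  moreover have "card (induced J X \<union> induced J Y) \<le> card (induced J (X \<union> Y))"
    using assms by (intro card_mono finite_induced) (auto simp: induced_def)
  moreover have "induced J X \<inter> induced J Y = induced J (X \<inter> Y)" by (auto simp: induced_def)
  ultimately show ?thesis by simp
qed

lemma card_Un_Int_V: "X \<subseteq> V \<Longrightarrow> Y \<subseteq> V \<Longrightarrow> card X + card Y = card (X \<union> Y) + card (X \<inter> Y)"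
  using finV by (intro card_Un_Int) (auto intro: finite_subset)

lemma indepD: "indep c J \<Longrightarrow> X \<subseteq> V \<Longrightarrow> X \<noteq> {} \<Longrightarrow> card (induced J X) + c \<le> card X"
  by (simp add: indep_def)

lemma indep_subset: "indep c K \<Longrightarrow> J \<subseteq> K \<Longrightarrow> K \<subseteq> A \<Longrightarrow> indep c J"
  unfolding indep_def
  by (meson add_le_mono1 card_mono finite_induced induced_mono order_refl order_trans)

text \<open>Uncrossing: supermodularity bounds the sum of the two counts from below and independence
  bounds each from above, so both upper bounds are attained.\<close>

lemma tight_on_Un_Int:
  assumes "J \<subseteq> A" "indep c J" "tight_on c J X" "tight_on c J Y" "X \<inter> Y \<noteq> {}"
  shows "tight_on c J (X \<union> Y)" and "tight_on c J (X \<inter> Y)"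
proof -
  have XY: "X \<subseteq> V" "Y \<subseteq> V" using assms by (auto simp: tight_on_def)
  have "card (induced J (X \<union> Y)) + c \<le> card (X \<union> Y)"
    using XY assms(5) by (intro indepD assms) auto
  moreover have "card (induced J (X \<inter> Y)) + c \<le> card (X \<inter> Y)"
    using XY assms(5) by (intro indepD assms) auto
  ultimately show "tight_on c J (X \<union> Y)" "tight_on c J (X \<inter> Y)"
    using card_induced_supermodular[OF assms(1), of X Y] card_Un_Int_V[OF XY] assms(3-5)
    by (auto simp: tight_on_def)
qed

lemma tight_on_mono:
  assumes "tight_on c J X" "J \<subseteq> K" "K \<subseteq> A" "indep c K"
  shows "tight_on c K X"
proof -
  have "card (induced J X) \<le> card (induced K X)"
    using assms by (intro card_mono finite_induced induced_mono) auto
  then show ?thesis using assms(1) indepD[OF assms(4), of X] by (auto simp: tight_on_def)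
qed

lemma span_mono: "J \<subseteq> K \<Longrightarrow> K \<subseteq> A \<Longrightarrow> indep c K \<Longrightarrow> span c J \<subseteq> span c K"
  unfolding span_def using tight_on_mono by blast

lemma induced_insert: "induced (insert e J) X = (if ed e \<subseteq> X then insert e (induced J X) else induced J X)"
  by (auto simp: induced_def)

text \<open>Used for recolouring in \<open>layer_swap\<close>: when \<open>e\<close> joins a class
  that already spans it, the span does not grow, even if other edges leave.\<close>

lemma span_exchange:
  assumes J: "J \<subseteq> A" "indep c J" and e: "e \<in> span c J"
    and K: "K \<subseteq> insert e J" "indep c K"
  shows "span c K \<subseteq> span c J"
proof -
  obtain Y where Y: "tight_on c J Y" "ed e \<subseteq> Y" and eA: "e \<in> A" using e by (auto simp: span_def)
  have KA: "K \<subseteq> A" using K J eA by auto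
  \<comment> \<open>If \<open>X\<close> is not already tight for \<open>J\<close>, it misses exactly the edge \<open>e\<close>; so it meets \<open>Y\<close>, and
    supermodularity makes \<open>X \<union> Y\<close> tight.\<close>
  have "\<exists>Z. tight_on c J Z \<and> X \<subseteq> Z" if X: "tight_on c K X" for X
  proof (cases "tight_on c J X")
    case False
    have XV: "X \<subseteq> V" "X \<noteq> {}" and cX: "card (induced K X) + c = card X"
      using X by (auto simp: tight_on_def)
    have less: "card (induced J X) < card (induced K X)"
      using False indepD[OF J(2) XV] cX XV by (auto simp: tight_on_def)
    have sub: "induced K X \<subseteq> induced (insert e J) X" using K by (intro induced_mono) auto
    have eX: "ed e \<subseteq> X" and eK: "e \<in> K"
    proof -
      have "\<not> induced K X \<subseteq> induced J X"
        using less card_mono[OF finite_induced[OF J(1)], of "induced K X" X] by linarith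
      then show "ed e \<subseteq> X" "e \<in> K" using K by (auto simp: induced_def)
    qed
    have eJ: "e \<notin> J"
    proof
      assume "e \<in> J"
      then have "induced K X \<subseteq> induced J X" using K by (auto simp: induced_def)
      then show False using less card_mono[OF finite_induced[OF J(1)], of "induced K X" X] by linarith
    qed
    \<comment> \<open>Inside \<open>X\<close>, \<open>K\<close> has strictly more edges than
      \<open>J\<close>, but none beyond those of \<open>J\<close> except \<open>e\<close>; so it
      keeps every edge of \<open>J\<close> there.\<close>
    have "induced K X = insert e (induced J X)"
    proof (rule card_seteq)
      show "finite (insert e (induced J X))" using J finite_induced by simp
      show "induced K X \<subseteq> insert e (induced J X)" using sub eX by (simp add: induced_insert)
      show "card (insert e (induced J X)) \<le> card (induced K X)"
        using less eJ J finite_induced by (simp add: induced_def card_insert_if)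
    qed
    then have KJ: "induced J X \<subseteq> K" and cK: "card (induced K X) = Suc (card (induced J X))"
      using eJ J finite_induced[of J X] by (auto simp: induced_def card_insert_if)
    have YV: "Y \<subseteq> V" "Y \<noteq> {}" and cY: "card (induced J Y) + c = card Y"
      using Y by (auto simp: tight_on_def)
    have ne: "X \<inter> Y \<noteq> {}" using eX Y ed_ne[OF eA] by auto
    \<comment> \<open>The edge \<open>e\<close> also lies in \<open>X \<inter> Y\<close>, where
      independence of \<open>K\<close> leaves \<open>J\<close> a slack of at least one. This offsets
      the single edge that \<open>J\<close> lacks on \<open>X\<close>.\<close>
    have "insert e (induced J (X \<inter> Y)) \<subseteq> induced K (X \<inter> Y)"
      using KJ eK eX Y by (auto simp: induced_def)
    then have "card (insert e (induced J (X \<inter> Y))) \<le> card (induced K (X \<inter> Y))"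
      by (intro card_mono finite_induced KA)
    then have "Suc (card (induced J (X \<inter> Y))) \<le> card (induced K (X \<inter> Y))"
      using eJ J finite_induced[of J "X \<inter> Y"] by (simp add: induced_def card_insert_if)
    moreover have "card (induced K (X \<inter> Y)) + c \<le> card (X \<inter> Y)"
      using ne XV by (intro indepD K) auto
    moreover have "card (induced J (X \<union> Y)) + c \<le> card (X \<union> Y)"
      using XV YV by (intro indepD J) auto
    ultimately have "card (induced J (X \<union> Y)) + c = card (X \<union> Y)"
      using card_induced_supermodular[OF J(1), of X Y] card_Un_Int_V[OF XV(1) YV(1)] cX cY cK by linarith
    then have "tight_on c J (X \<union> Y)" using XV YV by (auto simp: tight_on_def)
    then show ?thesis by blast
  qed auto
  then show ?thesis unfolding span_def by (blast intro: order_trans)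
qed

text \<open>The edges of \<open>I\<close> inside the least tight set around \<open>e\<close> form,
  together with \<open>e\<close>, its fundamental circuit. They cannot all lie in \<open>S\<close>,
  since \<open>I \<inter> S\<close> does not span \<open>e\<close>; dropping one outside
  \<open>S\<close> breaks the circuit.\<close>

lemma indep_exchange:
  assumes I: "I \<subseteq> A" "indep c I" and e: "e \<in> A" "e \<notin> I" "e \<notin> span c (I \<inter> S)"
    and dep: "\<not> indep c (insert e I)"
  obtains f where "f \<in> I" "f \<notin> S" "indep c (insert e (I - {f}))"
proof -
  \<comment> \<open>As \<open>I\<close> is independent, these are exactly the sets whose bound fails
    after inserting \<open>e\<close>.\<close>
  define \<T> where "\<T> = {X. tight_on c I X \<and> ed e \<subseteq> X}"
  have ins: "card (induced (insert e I) X) = (if ed e \<subseteq> X then Suc (card (induced I X)) else card (induced I X))" for X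
  proof -
    have "e \<notin> induced I X" using e by (simp add: induced_def)
    then show ?thesis using finite_induced[OF I(1), of X] by (simp add: induced_insert)
  qed
  obtain X0 where X0: "X0 \<subseteq> V" "X0 \<noteq> {}" "\<not> card (induced (insert e I) X0) + c \<le> card X0"
    using dep by (auto simp: indep_def)
  have "X0 \<in> \<T>"
    using X0 indepD[OF I(2) X0(1,2)] by (auto simp: ins \<T>_def tight_on_def split: if_splits)
  moreover have "finite \<T>"
    by (rule finite_subset[of _ "Pow V"]) (use finV in \<open>auto simp: \<T>_def tight_on_def\<close>)
  ultimately obtain C where C: "C \<in> \<T>" "\<And>X. X \<in> \<T> \<Longrightarrow> X \<subseteq> C \<Longrightarrow> X = C"
    using finite_has_minimal[of \<T>] by (metis empty_iff)
  \<comment> \<open>All members of \<open>\<T>\<close> contain the nonempty \<open>ed e\<close>, so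
    they uncross, and a minimal member is the least one.\<close>
  have C_least: "C \<subseteq> X" if "X \<in> \<T>" for X
  proof -
    have "C \<inter> X \<in> \<T>"
      using that C(1) tight_on_Un_Int(2)[OF I, of C X] ed_ne[OF e(1)] by (auto simp: \<T>_def)
    then show ?thesis using C(2)[of "C \<inter> X"] by auto
  qed
  have "\<not> induced I C \<subseteq> S"
  proof
    assume "induced I C \<subseteq> S"
    then have "induced (I \<inter> S) C = induced I C" by (auto simp: induced_def)
    then have "tight_on c (I \<inter> S) C" using C by (auto simp: \<T>_def tight_on_def)
    then show False using e C by (auto simp: span_def \<T>_def)
  qed
  then obtain f where f: "f \<in> I" "ed f \<subseteq> C" "f \<notin> S" by (auto simp: induced_def)
  have "indep c (insert e (I - {f}))"
    unfolding indep_def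
  proof (intro allI impI)
    fix X assume X: "X \<subseteq> V" "X \<noteq> {}"
    have finI: "finite (induced (insert e I) X)" using e I by (intro finite_induced) auto
    have le: "card (induced (insert e (I - {f})) X) \<le> card (induced (insert e I) X)"
      by (intro card_mono finI induced_mono) auto
    show "card (induced (insert e (I - {f})) X) + c \<le> card X"
    proof (cases "X \<in> \<T>")
      case False
      then show ?thesis using le ins[of X] indepD[OF I(2) X] X by (auto simp: \<T>_def tight_on_def split: if_splits)
    next
      case True
      \<comment> \<open>Every violated set contains \<open>C\<close>, so removing \<open>f\<close>
        repairs it.\<close>
      then have "f \<in> induced (insert e I) X" using C_least f by (auto simp: induced_def)
      moreover have "induced (insert e (I - {f})) X = induced (insert e I) X - {f}"
        using f e by (auto simp: induced_def)
      ultimately have "Suc (card (induced (insert e (I - {f})) X)) = card (induced (insert e I) X)"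
        using finI by (simp only: card_Suc_Diff1)
      then show ?thesis using True ins[of X] by (auto simp: \<T>_def tight_on_def)
    qed
  qed
  then show ?thesis using that f by blast
qed

section \<open>Layers of a colouring and matroid partition\<close>

text \<open>
  Elements with colour below \<open>k\<close> are covered, all others uncovered. The last layer containing an
  uncovered element measures how many exchanges are needed to cover it.
\<close>

primrec layer :: "(nat \<Rightarrow> nat) \<Rightarrow> nat \<Rightarrow> ('i \<Rightarrow> nat) \<Rightarrow> nat \<Rightarrow> 'i set" where
  "layer c k col 0 = A"
| "layer c k col (Suc j) = {x \<in> A. \<forall>i<k. x \<in> span (c i) ({y \<in> A. col y = i} \<inter> layer c k col j)}"

definition indep_colouring :: "(nat \<Rightarrow> nat) \<Rightarrow> nat \<Rightarrow> ('i \<Rightarrow> nat) \<Rightarrow> bool" where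
  "indep_colouring c k col \<longleftrightarrow> (\<forall>i<k. indep (c i) {x \<in> A. col x = i})"

lemma layer_subset: "layer c k col j \<subseteq> A"
  by (cases j) auto

lemma indep_colour_class:
  "indep_colouring c k col \<Longrightarrow> i < k \<Longrightarrow> indep (c i) ({x \<in> A. col x = i} \<inter> S)"
  unfolding indep_colouring_def by (rule indep_subset[of _ "{x \<in> A. col x = i}"]) auto

text \<open>The layers iterate a monotone operator from its top element \<open>A\<close>, so they
  descend although \<open>span\<close> is not extensive.\<close>

lemma layer_Suc_subset:
  assumes "indep_colouring c k col"
  shows "layer c k col (Suc j) \<subseteq> layer c k col j"
proof (induction j)
  case (Suc j)
  have "span (c i) ({y \<in> A. col y = i} \<inter> layer c k col (Suc j))
      \<subseteq> span (c i) ({y \<in> A. col y = i} \<inter> layer c k col j)" if "i < k" for i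
    using Suc that by (intro span_mono indep_colour_class[OF assms]) auto
  then show ?case by (simp only: layer.simps) blast
qed auto

lemma layer_antimono:
  "indep_colouring c k col \<Longrightarrow> j \<le> m \<Longrightarrow> layer c k col m \<subseteq> layer c k col j"
  by (rule lift_Suc_antimono_le[of "layer c k col"]) (auto dest: layer_Suc_subset simp del: layer.simps)

text \<open>Only class \<open>i\<close> gains an element, namely \<open>e\<close>. Up to layer
  \<open>m\<close>, the old class within the layer already spans \<open>e\<close>, so
  \<open>span_exchange\<close> applies; the other classes only lose elements.\<close>

lemma layer_swap:
  assumes col: "indep_colouring c k col" and col': "indep_colouring c k col'"
    and i: "i < k" and col'_def: "col' = col(e := i, f := k)"
    and e: "e \<in> layer c k col m"
  shows "j \<le> m \<Longrightarrow> layer c k col' j \<subseteq> layer c k col j"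
proof (induction j)
  case (Suc j)
  then have IH: "layer c k col' j \<subseteq> layer c k col j" by simp
  have "span (c h) ({y \<in> A. col' y = h} \<inter> layer c k col' j)
      \<subseteq> span (c h) ({y \<in> A. col y = h} \<inter> layer c k col j)" if h: "h < k" for h
  proof (cases "h = i")
    case True
    have "e \<in> layer c k col (Suc j)" using layer_antimono[OF col Suc.prems] e by blast
    then have "e \<in> span (c h) ({y \<in> A. col y = h} \<inter> layer c k col j)" using h by simp
    then show ?thesis
      using IH
      by (intro span_exchange[of _ _ e] indep_colour_class[OF col h] indep_colour_class[OF col' h])
        (use h in \<open>auto simp: col'_def split: if_splits\<close>)
  next
    case False
    then show ?thesis
      using IH by (intro span_mono indep_colour_class[OF col h]) (use h False in \<open>auto simp: col'_def split: if_splits\<close>)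
  qed
  then show ?case by (simp only: layer.simps) blast
qed simp

text \<open>For each class, the maximal tight set \<open>X i\<close> around \<open>e\<close> absorbs
  every tight set meeting it. Since each edge of \<open>S\<close> lies in a tight set of every
  class, an edge of \<open>S\<close> meeting the intersection \<open>C\<close> of all
  \<open>X i\<close> lies in \<open>C\<close>. No edge of \<open>S\<close> then joins
  \<open>C\<close> to \<open>X i - C\<close>, so the tightness of \<open>X i\<close> passes to
  \<open>C\<close>.\<close>

lemma common_tight_set:
  assumes col: "indep_colouring c k col" and k: "0 < k"
    and S: "S \<subseteq> A" "\<And>i. i < k \<Longrightarrow> S \<subseteq> span (c i) ({y \<in> A. col y = i} \<inter> S)"
    and e: "e \<in> S"
  obtains C where "C \<subseteq> V" "ed e \<subseteq> C" "\<And>i. i < k \<Longrightarrow> tight_on (c i) ({y \<in> A. col y = i} \<inter> S) C"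
proof -
  define J where "J i = {y \<in> A. col y = i} \<inter> S" for i
  have J: "J i \<subseteq> A" "i < k \<Longrightarrow> indep (c i) (J i)" for i
    using indep_colour_class[OF col] by (auto simp: J_def)
  have ex: "\<exists>X. tight_on (c i) (J i) X \<and> ed x \<subseteq> X" if "i < k" "x \<in> S" for i x
    using S(2)[OF that(1)] that(2) by (auto simp: span_def J_def)
  have "\<exists>X. tight_on (c i) (J i) X \<and> ed e \<subseteq> X \<and> (\<forall>Y. tight_on (c i) (J i) Y \<and> X \<inter> Y \<noteq> {} \<longrightarrow> Y \<subseteq> X)"
    if i: "i < k" for i
  proof -
    let ?T = "{X. tight_on (c i) (J i) X \<and> ed e \<subseteq> X}"
    have "finite ?T"
      by (rule finite_subset[of _ "Pow V"]) (use finV in \<open>auto simp: tight_on_def\<close>)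
    moreover have "?T \<noteq> {}" using ex[OF i e] by blast
    ultimately obtain X where X: "X \<in> ?T" "\<And>Y. Y \<in> ?T \<Longrightarrow> X \<subseteq> Y \<Longrightarrow> X = Y"
      using finite_has_maximal[of ?T] by metis
    have "Y \<subseteq> X" if "tight_on (c i) (J i) Y" "X \<inter> Y \<noteq> {}" for Y
      using X(2)[of "X \<union> Y"] X(1) tight_on_Un_Int(1)[OF J(1) J(2)[OF i], of X Y] that by blast
    then show ?thesis using X by blast
  qed
  then obtain X where X: "\<And>i. i < k \<Longrightarrow> tight_on (c i) (J i) (X i)" "\<And>i. i < k \<Longrightarrow> ed e \<subseteq> X i"
    "\<And>i Y. i < k \<Longrightarrow> tight_on (c i) (J i) Y \<Longrightarrow> X i \<inter> Y \<noteq> {} \<Longrightarrow> Y \<subseteq> X i"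
    by metis
  define C where "C = (\<Inter>i<k. X i)"
  have CX: "C \<subseteq> X i" if "i < k" for i using that by (auto simp: C_def)
  have XV: "X i \<subseteq> V" if "i < k" for i using X(1)[OF that] by (simp add: tight_on_def)
  have CV: "C \<subseteq> V" using CX[OF k] XV[OF k] by simp
  have eC: "ed e \<subseteq> C" using X(2) by (auto simp: C_def)
  have Cne: "C \<noteq> {}" using eC ed_ne e S by blast
  have closed: "ed x \<subseteq> C" if x: "x \<in> S" "ed x \<inter> C \<noteq> {}" for x
  proof -
    have "ed x \<subseteq> X i" if i: "i < k" for i
    proof -
      obtain Y where Y: "tight_on (c i) (J i) Y" "ed x \<subseteq> Y" using ex[OF i x(1)] by blast
      then have "X i \<inter> Y \<noteq> {}" using x(2) CX[OF i] by blast
      then show ?thesis using X(3)[OF i Y(1)] Y(2) by blast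
    qed
    then show ?thesis by (auto simp: C_def)
  qed
  have "tight_on (c i) (J i) C" if i: "i < k" for i
  proof -
    have fin: "finite (X i)" "finite C" using XV[OF i] CV finV finite_subset by auto
    \<comment> \<open>This bound without \<open>c i\<close> is enough, because the whole deficit
      \<open>c i\<close> of \<open>X i\<close> is charged to \<open>C\<close>; it also allows
      \<open>X i = C\<close>.\<close>
    have D: "card (induced (J i) (X i - C)) \<le> card (X i - C)"
    proof (cases "X i - C = {}")
      case True
      then have "induced (J i) (X i - C) = {}" unfolding True induced_def using ed_ne J(1) by blast
      then show ?thesis by (metis card.empty le0)
    next
      case False
      then show ?thesis using indepD[OF J(2)[OF i], of "X i - C"] XV[OF i] by force
    qed
    have "induced (J i) (X i) \<subseteq> induced (J i) C \<union> induced (J i) (X i - C)"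
      using closed by (auto simp: induced_def J_def)
    then have "card (induced (J i) (X i)) \<le> card (induced (J i) C \<union> induced (J i) (X i - C))"
      by (intro card_mono finite_UnI finite_induced J)
    also have "\<dots> \<le> card (induced (J i) C) + card (induced (J i) (X i - C))" by (rule card_Un_le)
    finally have "card (induced (J i) (X i)) \<le> card (induced (J i) C) + card (X i - C)"
      using D by linarith
    moreover have "card (X i - C) + card C = card (X i)"
      using CX[OF i] fin by (simp add: card_Diff_subset card_mono)
    moreover have "card (induced (J i) (X i)) + c i = card (X i)"
      using X(1)[OF i] by (simp add: tight_on_def)
    moreover have "card (induced (J i) C) + c i \<le> card C" using indepD[OF J(2)[OF i] CV Cne] .
    ultimately show ?thesis using CV Cne by (simp add: tight_on_def)
  qed
  then show ?thesis using that CV eC by (simp add: J_def)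
qed

lemma indep_partition:
  assumes k: "0 < k" and c: "\<And>i. i < k \<Longrightarrow> c i \<le> 1"
    and sparse: "\<And>X. X \<subseteq> V \<Longrightarrow> induced A X \<noteq> {} \<Longrightarrow> card (induced A X) + (\<Sum>i<k. c i) \<le> k * card X"
  obtains col where "\<And>x. x \<in> A \<Longrightarrow> col x < k" "indep_colouring c k col"
proof -
  define covered where "covered col = card {x \<in> A. col x < k}" for col :: "'i \<Rightarrow> nat"
  \<comment> \<open>The maximisation starts from the empty cover. Its classes are empty, and
    \<open>c i \<le> 1\<close> makes them independent.\<close>
  have "indep_colouring c k (\<lambda>_. k)"
  proof -
    have "c i \<le> card X" if "i < k" "X \<subseteq> V" "X \<noteq> {}" for i X
      using c[OF that(1)] that finV by (metis One_nat_def Suc_leI card_gt_0_iff finite_subset order_trans)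
    then show ?thesis by (auto simp: indep_colouring_def indep_def induced_def)
  qed
  moreover have "covered col < Suc (card A)" for col unfolding less_Suc_eq_le covered_def using finA by (intro card_mono) auto
  ultimately obtain col0 where col0: "indep_colouring c k col0"
    "\<And>col. indep_colouring c k col \<Longrightarrow> covered col \<le> covered col0"
    using ex_has_greatest_nat[of "indep_colouring c k" _ covered "Suc (card A)"] by metis
  \<comment> \<open>Recolouring \<open>e\<close> uncovers some \<open>f\<close> outside layer \<open>m\<close>, and no layer up to \<open>m\<close> grows: so \<open>f\<close>
    leaves the layers earlier than \<open>e\<close>.\<close>
  have no_escape: "\<not> (indep_colouring c k col \<and> covered col = covered col0 \<and> e \<in> A \<and> k \<le> col e
      \<and> e \<in> layer c k col m \<and> e \<notin> layer c k col (Suc m))" for col e m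
  proof (induction m arbitrary: col e rule: less_induct)
    case (less m)
    show ?case
    proof
      assume as: "indep_colouring c k col \<and> covered col = covered col0 \<and> e \<in> A \<and> k \<le> col e
        \<and> e \<in> layer c k col m \<and> e \<notin> layer c k col (Suc m)"
      then obtain i where i: "i < k" "e \<notin> span (c i) ({y \<in> A. col y = i} \<inter> layer c k col m)"
        by auto
      define I where "I = {y \<in> A. col y = i}"
      have I: "I \<subseteq> A" "indep (c i) I" "e \<notin> I" using as i by (auto simp: I_def indep_colouring_def)
      show False
      proof (cases "indep (c i) (insert e I)")
        case True
        have "{x \<in> A. (col(e := i)) x = h} \<subseteq> {x \<in> A. col x = h}" if "h \<noteq> i" for h
          using that by auto
        moreover have "{x \<in> A. (col(e := i)) x = i} = insert e I" using as by (auto simp: I_def)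
        ultimately have "indep_colouring c k (col(e := i))"
          using True as unfolding indep_colouring_def
          by (metis (no_types, lifting) indep_subset mem_Collect_eq subsetI)
        then have "covered (col(e := i)) \<le> covered col" using col0 as by metis
        moreover have "{x \<in> A. (col(e := i)) x < k} = insert e {x \<in> A. col x < k}" using as i by auto
        ultimately show False using as finA by (simp add: covered_def)
      next
        case False
        obtain f where f: "f \<in> I" "f \<notin> layer c k col m" "indep (c i) (insert e (I - {f}))"
          using indep_exchange[OF I(1,2) _ I(3) _ False] i as unfolding I_def by blast
        define col' where "col' = col(e := i, f := k)"
        have fe: "f \<noteq> e" "f \<in> A" "col f = i" using f I by (auto simp: I_def)
        have "{x \<in> A. col' x = h} \<subseteq> {x \<in> A. col x = h}" if "h \<noteq> i" "h < k" for h
          using that by (auto simp: col'_def)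
        moreover have "{x \<in> A. col' x = i} = insert e (I - {f})"
          using as i fe by (auto simp: I_def col'_def)
        ultimately have col': "indep_colouring c k col'"
          using f(3) as unfolding indep_colouring_def
          by (metis (no_types, lifting) indep_subset mem_Collect_eq subsetI)
        have "{x \<in> A. col' x < k} = insert e ({x \<in> A. col x < k} - {f})"
          using as i fe by (auto simp: col'_def)
        moreover have "f \<in> {x \<in> A. col x < k}" using fe i by auto
        ultimately have cov: "covered col' = covered col"
          using as finA by (simp add: covered_def card_Suc_Diff1 del: card_Diff_insert)
        have sub: "layer c k col' m \<subseteq> layer c k col m"
          using layer_swap[OF _ col' i(1) col'_def, of m m] as by blast
        then have fm: "f \<notin> layer c k col' m" using f by blast
        \<comment> \<open>Layer 0 is all of \<open>A\<close>, so \<open>f\<close> has a last layer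
          \<open>n\<close> before it first drops out, and it has dropped out by layer
          \<open>m\<close>.\<close>
        obtain n where n: "n < m" "f \<in> layer c k col' n" "f \<notin> layer c k col' (Suc n)"
        proof -
          define p where "p = (LEAST p. f \<notin> layer c k col' p)"
          have p: "f \<notin> layer c k col' p" "p \<le> m"
            using LeastI[of "\<lambda>p. f \<notin> layer c k col' p", OF fm] Least_le[of "\<lambda>p. f \<notin> layer c k col' p", OF fm]
            by (auto simp: p_def)
          then have "p \<noteq> 0" using fe by (metis layer.simps(1))
          then obtain n where pn: "p = Suc n" by (metis not0_implies_Suc)
          then have "f \<in> layer c k col' n" using not_less_Least[of n "\<lambda>p. f \<notin> layer c k col' p"] p_def by auto
          then show ?thesis using that[of n] p pn by (simp del: layer.simps)
        qed
        have "k \<le> col' f" by (simp add: col'_def)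
        then show False using less[OF n(1), of col' f] n cov as col' fe by auto
      qed
    qed
  qed
  have "col0 x < k" if x: "x \<in> A" for x
  proof (rule ccontr)
    assume nx: "\<not> col0 x < k"
    have x_layer: "x \<in> layer c k col0 m" for m
    proof (induction m)
      case (Suc m)
      then show ?case using no_escape[of col0 x m] col0 nx x by (auto simp del: layer.simps)
    qed (use x in simp)
    \<comment> \<open>A layer of least size equals its successor; this gives the fixed point
      \<open>S\<close> required by \<open>common_tight_set\<close>.\<close>
    obtain m where m: "layer c k col0 (Suc m) = layer c k col0 m"
    proof -
      obtain m where m: "\<And>n. card (layer c k col0 m) \<le> card (layer c k col0 n)"
        using ex_has_least_nat[of "\<lambda>_. True" 0 "\<lambda>m. card (layer c k col0 m)"] by auto
      have "layer c k col0 (Suc m) = layer c k col0 m"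
        using layer_Suc_subset[OF col0(1)] m[of "Suc m"] finite_subset[OF layer_subset finA]
        by (intro card_seteq) auto
      then show ?thesis using that by blast
    qed
    define S where "S = layer c k col0 m"
    have SA: "S \<subseteq> A" and xS: "x \<in> S" using layer_subset x_layer by (auto simp: S_def)
    have S: "S \<subseteq> span (c i) ({y \<in> A. col0 y = i} \<inter> S)" if "i < k" for i
      using m that unfolding S_def layer.simps by blast
    obtain C where C: "C \<subseteq> V" "ed x \<subseteq> C" "\<And>i. i < k \<Longrightarrow> tight_on (c i) ({y \<in> A. col0 y = i} \<inter> S) C"
      using common_tight_set[OF col0(1) k SA S xS] by blast
    define B where "B i = induced ({y \<in> A. col0 y = i} \<inter> S) C" for i
    have finB: "finite (B i)" for i unfolding B_def by (rule finite_induced) auto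
    \<comment> \<open>The uncovered \<open>x\<close> is one edge in \<open>C\<close> beyond those of
      the \<open>k\<close> tight classes, which already exhaust the sparsity bound.\<close>
    have "card (insert x (\<Union>i<k. B i)) \<le> card (induced A C)"
      using C(2) x by (intro card_mono finite_induced) (auto simp: B_def induced_def)
    moreover have "x \<notin> (\<Union>i<k. B i)" using nx by (auto simp: B_def induced_def)
    ultimately have "Suc (card (\<Union>i<k. B i)) \<le> card (induced A C)" using finB by simp
    moreover have "card (\<Union>i<k. B i) = (\<Sum>i<k. card (B i))"
      using finB by (intro card_UN_disjoint) (auto simp: B_def induced_def)
    moreover have "(\<Sum>i<k. card (B i)) + (\<Sum>i<k. c i) = (\<Sum>i<k. card C)"
      unfolding sum.distrib[symmetric] using C(3) by (intro sum.cong) (auto simp: B_def tight_on_def)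
    moreover have "card (induced A C) + (\<Sum>i<k. c i) \<le> k * card C"
      using C x by (intro sparse) (auto simp: induced_def)
    ultimately show False by simp
  qed
  then show ?thesis using that col0 by blast
qed

section \<open>Trees and maps from independent classes\<close>

definition edges :: "'i set \<Rightarrow> 'a set multiset" where
  "edges J = image_mset ed (mset_set J)"

lemma size_edges: "size (edges J) = card J"
  by (simp add: edges_def)

lemma filter_edges: "J \<subseteq> A \<Longrightarrow> filter_mset P (edges J) = edges {x \<in> J. P (ed x)}"
  using finA by (simp add: edges_def filter_mset_image_mset finite_subset)

lemma set_edges: "J \<subseteq> A \<Longrightarrow> set_mset (edges J) = ed ` J"
  using finA by (simp add: edges_def finite_subset)

lemma hypergraph_edges: "J \<subseteq> A \<Longrightarrow> hypergraph V (edges J)"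
  using ed_V ed_ne finV by (force simp: hypergraph_def set_edges)

lemma sum_edges_colour_classes:
  fixes col :: "'i \<Rightarrow> nat"
  shows "(\<Sum>i<n. edges {x \<in> A. col x = i}) = edges {x \<in> A. col x < n}"
proof (induction n)
  case (Suc n)
  have "{x \<in> A. col x < Suc n} = {x \<in> A. col x < n} \<union> {x \<in> A. col x = n}" by auto
  moreover have "mset_set ({x \<in> A. col x < n} \<union> {x \<in> A. col x = n})
      = mset_set {x \<in> A. col x < n} + mset_set {x \<in> A. col x = n}"
    using finA by (intro mset_set_Union) auto
  ultimately show ?case using Suc by (simp add: edges_def)
qed (simp add: edges_def)

text \<open>Each part \<open>X\<close> of a partition \<open>P\<close> contains at most
  \<open>card X - 1\<close> edges, so at most \<open>card V - card P\<close> edges do not cross, and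
  at least \<open>card P - 1\<close> do.\<close>

lemma hypertree_edges:
  assumes J: "J \<subseteq> A" "indep 1 J" and card_J: "card J + 1 = card V"
  shows "hypertree V (edges J)"
proof -
  have finJ: "finite J" using J finA finite_subset by blast
  have "int (card P) - 1 \<le> int (size (filter_mset (crossing P) (edges J)))" if P: "partition_on V P" for P
  proof -
    have finP: "finite P" using P finV by (rule finite_elements[rotated])
    have PV: "X \<subseteq> V" "X \<noteq> {}" if "X \<in> P" for X
      using that P by (auto simp: partition_on_def)
    let ?Cr = "{x \<in> J. crossing P (ed x)}"
    have "J \<subseteq> ?Cr \<union> (\<Union>X\<in>P. induced J X)"
    proof
      fix x assume x: "x \<in> J"
      then obtain v where v: "v \<in> ed x" "ed x \<subseteq> V" using J ed_V ed_ne by blast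
      then obtain X where X: "X \<in> P" "v \<in> X" using partition_onD1[OF P] by blast
      have "ed x \<subseteq> X" if "\<not> crossing P (ed x)"
      proof
        fix w assume w: "w \<in> ed x"
        then obtain Y where Y: "Y \<in> P" "w \<in> Y" using v partition_onD1[OF P] by blast
        then have "X = Y" using that X v w unfolding crossing_def by blast
        then show "w \<in> X" using Y by simp
      qed
      then show "x \<in> ?Cr \<union> (\<Union>X\<in>P. induced J X)" using x X by (auto simp: induced_def)
    qed
    then have "card J \<le> card (?Cr \<union> (\<Union>X\<in>P. induced J X))"
      using finJ finP by (intro card_mono) (auto simp: induced_def)
    also have "\<dots> \<le> card ?Cr + card (\<Union>X\<in>P. induced J X)" by (rule card_Un_le)
    also have "card (\<Union>X\<in>P. induced J X) \<le> (\<Sum>X\<in>P. card (induced J X))"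
      by (rule card_UN_le[OF finP])
    finally have "card J \<le> card ?Cr + (\<Sum>X\<in>P. card (induced J X))" by simp
    moreover have "(\<Sum>X\<in>P. card (induced J X) + 1) \<le> (\<Sum>X\<in>P. card X)"
      using PV J by (intro sum_mono indepD) auto
    moreover have "(\<Sum>X\<in>P. card X) = card V"
      using card_Union_disjoint[of P] P PV finV finite_subset unfolding partition_on_def by metis
    ultimately have "card P \<le> card ?Cr + 1" using card_J by (simp add: sum_Suc)
    then show ?thesis using J by (simp add: filter_edges size_edges)
  qed
  then have conn: "one_partition_connected V (edges J)"
    using hypergraph_edges[OF J(1)] by (simp add: one_partition_connected_def)
  have "\<not> one_partition_connected V (edges J - {#f#})" if f: "f \<in># edges J" for f
  proof
    assume *: "one_partition_connected V (edges J - {#f#})"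
    \<comment> \<open>The partition into singletons demands \<open>card V - 1\<close> edges, one
      more than remain.\<close>
    let ?P = "(\<lambda>v. {v}) ` V"
    have "partition_on V ?P" by (auto simp: partition_on_def disjoint_def)
    then have "int (card ?P) - 1 \<le> int (size (filter_mset (crossing ?P) (edges J - {#f#})))"
      using * by (simp add: one_partition_connected_def)
    also have "\<dots> \<le> int (size (edges J - {#f#}))" by (simp only: of_nat_le_iff size_filter_mset_lesseq)
    also have "card ?P = card V" by (simp add: card_image)
    finally have "card V \<le> Suc (size (edges J - {#f#}))" by linarith
    also have "\<dots> = card J" using f by (metis size_Suc_Diff1 size_edges)
    finally show False using card_J by simp
  qed
  then show ?thesis using conn by (simp add: hypertree_def)
qed

text \<open>Independence applied to the union of the edges in \<open>K\<close> is Hall's condition.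
  The distinct representatives serve as tails, and \<open>card J = card V\<close> makes every vertex
  a tail.\<close>

lemma hypermap_edges:
  assumes J: "J \<subseteq> A" "indep 0 J" and card_J: "card J = card V"
  shows "hypermap V (edges J)"
proof -
  have finJ: "finite J" using J finA finite_subset by blast
  have "\<exists>t. inj_on t J \<and> (\<forall>x\<in>J. t x \<in> ed x)"
  proof (rule hall_marriage[OF finJ])
    show "finite (ed x)" if "x \<in> J" for x using that J ed_V finV finite_subset by blast
    fix K assume K: "K \<subseteq> J"
    show "card K \<le> card (\<Union>(ed ` K))"
    proof (cases "K = {}")
      case False
      have "card K \<le> card (induced J (\<Union>(ed ` K)))"
        using K J by (intro card_mono finite_induced) (auto simp: induced_def)
      moreover have "\<Union>(ed ` K) \<subseteq> V" using K J ed_V by blast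
      moreover have "\<Union>(ed ` K) \<noteq> {}" using K J ed_ne False by blast
      ultimately show ?thesis using indepD[OF J(2), of "\<Union>(ed ` K)"] by simp
    qed simp
  qed
  then obtain t where t: "inj_on t J" "\<And>x. x \<in> J \<Longrightarrow> t x \<in> ed x" by blast
  have "t ` J \<subseteq> V" using t J ed_V by blast
  then have tJ: "t ` J = V" using card_J finV t by (simp add: card_image card_subset_eq)
  define D where "D = image_mset (\<lambda>x. (ed x, t x)) (mset_set J)"
  have "orientation (edges J) D"
    using t finJ by (auto simp: orientation_def D_def edges_def multiset.map_comp comp_def)
  moreover have "size {#p \<in># D. snd p = v#} = 1" if v: "v \<in> V" for v
  proof -
    obtain x where x: "x \<in> J" "t x = v" using v tJ by blast
    then have "{y \<in> J. t y = v} = {x}" using t by (auto simp: inj_on_def)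
    then show ?thesis using finJ by (simp add: D_def filter_mset_image_mset)
  qed
  ultimately show ?thesis using hypergraph_edges[OF J(1)] by (auto simp: hypermap_def)
qed

end

section \<open>Decomposition of a tight hypergraph\<close>

theorem mainTheorem6:
  fixes V :: "'a set" and E :: "'a set multiset" and k l s :: nat
  assumes "k \<ge> 1"
    and "l \<le> k"
    and "tight k l V E"
    and "hdimension E = s"
    and "int l \<le> int s * int k - 1"
  shows "\<exists>E1 E2. E = E1 + E2 \<and> arborescence l V E1 \<and> multi_hypermap (k - l) V E2"
proof -
  have hyp: "hypergraph V E" and size_E: "size E + l = k * card V"
    using assms(3) by (auto simp: tight_def sparse_def simp flip: of_nat_mult of_nat_add)
  obtain xs where xs: "mset xs = E" using ex_mset by blast
  \<comment> \<open>Positions in a listing of \<open>E\<close> serve as indices, one for each copy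
    of an edge.\<close>
  define A where "A = {..<length xs}"
  have nth: "xs ! x \<in># E" if "x \<in> A" for x using that xs by (auto simp: A_def)
  interpret indexed_hypergraph V A "(!) xs"
    using hyp nth by unfold_locales (auto simp: hypergraph_def A_def)
  have edges_A: "edges A = E"
    by (simp add: edges_def A_def lessThan_atLeast0 map_nth xs flip: mset_upt mset_map)
  \<comment> \<open>The first \<open>l\<close> classes are to become trees and the others maps, so
    the deficits add up to \<open>l\<close>.\<close>
  define c :: "nat \<Rightarrow> nat" where "c i = (if i < l then 1 else 0)" for i
  have "{..<k} \<inter> {i. i < l} = {..<l}" using assms(2) by auto
  then have sum_c: "(\<Sum>i<k. c i) = l" by (simp add: c_def sum.If_cases)
  have sparse: "card (induced A X) + (\<Sum>i<k. c i) \<le> k * card X" if "X \<subseteq> V" "induced A X \<noteq> {}" for X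
  proof -
    have eq: "edges_in E X = edges (induced A X)"
      by (simp add: edges_in_def filter_edges induced_def flip: edges_A)
    then have "edges_in E X \<noteq> {#}"
      using that finite_induced[of A X] by (simp add: edges_def mset_set_empty_iff)
    then have "int (size (edges_in E X)) \<le> int k * int (card X) - int l"
      using assms(3) that by (simp add: tight_def sparse_def)
    then show ?thesis unfolding eq size_edges sum_c by (simp flip: of_nat_mult of_nat_add)
  qed
  have "0 < k" "c i \<le> 1" for i using assms(1) by (auto simp: c_def)
  from indep_partition[OF this sparse]
  obtain col where col: "\<And>x. x \<in> A \<Longrightarrow> col x < k" "indep_colouring c k col" by blast
  define J where "J i = {x \<in> A. col x = i}" for i
  have JA: "J i \<subseteq> A" for i by (auto simp: J_def)
  have J_indep: "indep (c i) (J i)" if "i < k" for i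
    using col(2) that by (simp add: indep_colouring_def J_def)
  have sum_J: "(\<Sum>i<k. edges (J i)) = E"
  proof -
    have "{x \<in> A. col x < k} = A" using col(1) by auto
    then show ?thesis using sum_edges_colour_classes[where n = k and col = col] edges_A by (simp add: J_def)
  qed
  have J_le: "card (J i) + c i \<le> card V" if i: "i < k" for i
  proof (cases "V = {}")
    \<comment> \<open>Independence says nothing about the empty vertex set; but then there are no
      edges, and tightness gives \<open>l = 0\<close>.\<close>
    case True
    then have "A = {}" using ed_V ed_ne by blast
    moreover have "l = 0" using size_E True by simp
    ultimately show ?thesis by (simp add: J_def c_def)
  next
    case False
    have "induced (J i) V = J i" using ed_V by (auto simp: induced_def J_def)
    then show ?thesis using indepD[OF J_indep[OF i] subset_refl False] by simp
  qed
  have "(\<Sum>i<k. card (J i)) = size E"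
    unfolding sum_J[symmetric] by (simp add: size_edges size_multiset_sum)
  then have sum_eq: "(\<Sum>i<k. card (J i) + c i) = (\<Sum>i<k. card V)"
    using size_E by (simp add: sum.distrib sum_c)
  \<comment> \<open>No summand exceeds \<open>card V\<close> and the totals agree, so no class has
    slack. Here the edge count from tightness enters.\<close>
  have J_eq: "card (J i) + c i = card V" if "i < k" for i
    by (rule sum_mono_inv[OF sum_eq]) (use J_le that in auto)
  define E1 where "E1 = (\<Sum>i<l. edges (J i))"
  define E2 where "E2 = (\<Sum>i<k - l. edges (J (l + i)))"
  \<comment> \<open>The sum is split at \<open>l\<close> and its second block reindexed from 0; a
    free \<open>m\<close> makes induction possible.\<close>
  have "(\<Sum>i<l + m. edges (J i)) = E1 + (\<Sum>i<m. edges (J (l + i)))" for m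
    by (induction m) (simp_all add: E1_def add.assoc)
  from this[of "k - l"] have E12: "E = E1 + E2" using assms(2) sum_J by (simp add: E2_def)
  have "hypergraph V E1" "hypergraph V E2" using hyp E12 by (auto simp: hypergraph_def)
  moreover have "hypertree V (edges (J i))" if "i < l" for i
    using that assms(2) J_indep[of i] J_eq[of i] by (intro hypertree_edges JA) (auto simp: c_def)
  moreover have "hypermap V (edges (J (l + i)))" if "i < k - l" for i
    using that J_indep[of "l + i"] J_eq[of "l + i"] by (intro hypermap_edges JA) (auto simp: c_def)
  ultimately have "arborescence l V E1" "multi_hypermap (k - l) V E2"
    unfolding arborescence_def multi_hypermap_def E1_def E2_def
    by (auto intro: exI[of _ "\<lambda>i. edges (J i)"] exI[of _ "\<lambda>i. edges (J (l + i))"])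
  then show ?thesis using E12 by blast
qed

end
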